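(* Let $n\ge 0$ and define $F_n:\mathcal{A}_{n+1}\to\mathcal{B}_n$ by $F_n(\sigma)=\widetilde{\sigma}$, where for $1\le i\le n$ \[\widetilde{\sigma}_i=\begin{cases}\sigma_{i+1}-\sigma_1 & \text{if } \sigma_{i+1}<\sigma_1,\\ \sigma_{i+1}-1 & \text{if } \sigma_{i+1}>\sigma_1,\end{cases}\] $\widetilde{\sigma}_{-i}=-\widetilde{\sigma}_i$ and $\widetilde{\sigma}_0=0$. Then for $0\le j,k\le n$, $F_n$ maps $\mathcal{A}_{n+1,k}$ into $\mathcal{B}_{n,k}$, and $F_n$ restricted to $\mathcal{A}_{n+1,k,j+1}$ is a bijection onto $\mathcal{B}_{n,k,\{1,\ldots,j\}}$. Consequently $b(n,k,j)=|\mathcal{A}_{n+1,k,j+1}|$.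
   Context: $\mathcal{A}_m$ is the set of permutations of $\{1,\ldots,m\}$, identified with sequences $(\sigma_1,\ldots,\sigma_m)$; the number of descents of such a sequence is the number of $i$ with $\sigma_i>\sigma_{i+1}$. $\mathcal{A}_{m,k}$ is the set of $\sigma\in\mathcal{A}_m$ with $k$ descents, and $\mathcal{A}_{m,k,j}=\{\sigma\in\mathcal{A}_{m,k}:\sigma_1=j\}$. $\mathcal{B}_n$ is the set of signed permutations of order $n$: bijections $\sigma$ of $\{-n,\ldots,n\}$ with $\sigma(-i)=-\sigma(i)$, identified with $(0,\sigma_1,\ldots,\sigma_n)$; $\mathrm{des}(\sigma)$ is the number of $i\in\{1,\ldots,n\}$ with $\sigma_{i-1}>\sigma_i$ ($\sigma_0=0$). $\mathcal{B}_{n,k}=\{\sigma\in\mathcal{B}_n:\mathrm{des}(\sigma)=k\}$. For $U\subseteq\{1,\ldots,n\}$, $\mathcal{B}_{n,k,U}$ is the set of $\sigma\in\mathcal{B}_{n,k}$ such that for each $1\le i\le n$, $\sigma_i<0$ iff $|\sigma_i|\in U$. $b(n,k,j):=|\mathcal{B}_{n,k,\{1,\ldots,j\}}|$. *)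

theory Defs
  imports "HOL-Combinatorics.Permutations" "HOL-Library.FuncSet"
begin

(* A permutation of a finite set S is a function on the whole type satisfying
   "permutes S", i.e. extended by the identity outside S. *)

definition perms :: "nat \<Rightarrow> (nat \<Rightarrow> nat) set" where
  "perms m = {\<sigma>. \<sigma> permutes {1..m}}"

definition descents :: "nat \<Rightarrow> (nat \<Rightarrow> nat) \<Rightarrow> nat" where
  "descents m \<sigma> = card {i. 1 \<le> i \<and> i < m \<and> \<sigma> i > \<sigma> (i + 1)}"

definition perms_des :: "nat \<Rightarrow> nat \<Rightarrow> (nat \<Rightarrow> nat) set" where
  "perms_des m k = {\<sigma> \<in> perms m. descents m \<sigma> = k}"

definition perms_des_first :: "nat \<Rightarrow> nat \<Rightarrow> nat \<Rightarrow> (nat \<Rightarrow> nat) set" where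
  "perms_des_first m k j = {\<sigma> \<in> perms_des m k. \<sigma> 1 = j}"

definition signed_perms :: "nat \<Rightarrow> (int \<Rightarrow> int) set" where
  "signed_perms n = {\<sigma>. \<sigma> permutes {- int n..int n} \<and> (\<forall>i. \<sigma> (- i) = - \<sigma> i)}"

(* The index i = 1 compares with \<sigma> 0, which is 0 for a signed permutation. *)
definition signed_des :: "nat \<Rightarrow> (int \<Rightarrow> int) \<Rightarrow> nat" where
  "signed_des n \<sigma> = card {i \<in> {1..int n}. \<sigma> (i - 1) > \<sigma> i}"

definition signed_perms_des :: "nat \<Rightarrow> nat \<Rightarrow> (int \<Rightarrow> int) set" where
  "signed_perms_des n k = {\<sigma> \<in> signed_perms n. signed_des n \<sigma> = k}"

definition signed_perms_des_neg :: "nat \<Rightarrow> nat \<Rightarrow> nat set \<Rightarrow> (int \<Rightarrow> int) set" where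
  "signed_perms_des_neg n k U =
     {\<sigma> \<in> signed_perms_des n k. \<forall>i \<in> {1..int n}. \<sigma> i < 0 \<longleftrightarrow> \<bar>\<sigma> i\<bar> \<in> int ` U}"

definition b :: "nat \<Rightarrow> nat \<Rightarrow> nat \<Rightarrow> nat" where
  "b n k j = card (signed_perms_des_neg n k {1..j})"

(* For a permutation and i >= 1 the else case is exactly \<sigma> (i + 1) > \<sigma> 1. *)
definition tilde :: "(nat \<Rightarrow> nat) \<Rightarrow> nat \<Rightarrow> int" where
  "tilde \<sigma> i = (if \<sigma> (i + 1) < \<sigma> 1 then int (\<sigma> (i + 1)) - int (\<sigma> 1)
                else int (\<sigma> (i + 1)) - 1)"

(* The value i in the last case gives 0 at 0 and, outside {-n..n}, the identity
   required by "permutes". *)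
definition F :: "nat \<Rightarrow> (nat \<Rightarrow> nat) \<Rightarrow> int \<Rightarrow> int" where
  "F n \<sigma> i = (if 1 \<le> i \<and> i \<le> int n then tilde \<sigma> (nat i)
              else if - int n \<le> i \<and> i \<le> -1 then - tilde \<sigma> (nat (- i))
              else i)"

end

theory Submission
  imports Defs
begin

text \<open>
  The word \<open>F n \<sigma> 0, \<dots>, F n \<sigma> n\<close> arises from \<open>\<sigma> 1, \<dots>, \<sigma> (n + 1)\<close> by applying one strictly
  increasing relabelling of the values, which depends only on the first value \<open>\<sigma> 1 = j + 1\<close> and
  sends that value to \<open>0\<close>. Hence the descents agree position by position. The relabelling sends
  \<open>1, \<dots>, j\<close> to \<open>-j, \<dots>, -1\<close> and \<open>j + 2, \<dots>, n + 1\<close> to \<open>j + 1, \<dots>, n\<close>, which gives exactly the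
  sign pattern \<open>{1..j}\<close>, and inverting it recovers \<open>\<sigma>\<close>.
\<close>

text \<open>\<open>m\<close> stands for the first value \<open>\<sigma> 1\<close>. The middle case,
  absent from \<open>tilde\<close>, yields the entry \<open>0\<close> in position \<open>0\<close>,
  so that one map describes the whole signed word.\<close>

definition relabel :: "nat \<Rightarrow> nat \<Rightarrow> int" where
  "relabel m v = (if v < m then int v - int m else if v = m then 0 else int v - 1)"

text \<open>For \<open>m \<ge> 1\<close> this inverts \<open>relabel m\<close> on its range, which
  omits the integers strictly between \<open>0\<close> and \<open>m\<close>.\<close>

definition unlabel :: "nat \<Rightarrow> int \<Rightarrow> nat" where
  "unlabel m t = nat (if t < 0 then t + int m else if t = 0 then int m else t + 1)"

text \<open>The cases \<open>v < m\<close>, \<open>v = m\<close>, \<open>v > m\<close> give negative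
  values, \<open>0\<close>, and values at least \<open>m\<close>, and each case is increasing. With
  \<open>m = 0\<close> both \<open>0\<close> and \<open>1\<close> would go to
  \<open>0\<close>.\<close>

lemma relabel_less_iff:
  assumes "m \<ge> 1"
  shows "relabel m v < relabel m w \<longleftrightarrow> v < w"
  using assms by (auto simp: relabel_def)

lemma relabel_inj:
  assumes "m \<ge> 1" "relabel m v = relabel m w"
  shows "v = w"
  using assms relabel_less_iff[of m v w] relabel_less_iff[of m w v] by simp

text \<open>The absolute values in the three cases lie in disjoint ranges: \<open>1\<close> to
  \<open>m - 1\<close>, then \<open>0\<close>, then \<open>m\<close> upwards. The argument
  \<open>0\<close> must be excluded, since it would collide with \<open>m + 1\<close>.\<close>

lemma abs_relabel_inj:
  assumes "v \<ge> 1" "w \<ge> 1" "\<bar>relabel m v\<bar> = \<bar>relabel m w\<bar>"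
  shows "v = w"
  using assms by (auto simp: relabel_def split: if_splits)

lemma abs_relabel_le:
  assumes "m \<in> {1..n + 1}" "v \<in> {1..n + 1}"
  shows "\<bar>relabel m v\<bar> \<le> int n"
  using assms by (auto simp: relabel_def)

lemma abs_in_int_image_iff: "\<bar>t\<bar> \<in> int ` {1..j} \<longleftrightarrow> t \<noteq> 0 \<and> \<bar>t\<bar> \<le> int j"
  by (auto simp: image_iff intro!: bexI[of _ "nat \<bar>t\<bar>"])

lemma relabel_neg_iff:
  assumes "v \<ge> 1"
  shows "relabel (j + 1) v < 0 \<longleftrightarrow> \<bar>relabel (j + 1) v\<bar> \<in> int ` {1..j}"
  unfolding abs_in_int_image_iff using assms by (auto simp: relabel_def)

text \<open>The hypothesis says that \<open>t\<close> lies in \<open>{-j..0}\<close> or above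
  \<open>j\<close>, which is exactly the image of the positive naturals under
  \<open>relabel (j + 1)\<close>.\<close>

lemma relabel_unlabel:
  assumes "t < 0 \<longleftrightarrow> \<bar>t\<bar> \<in> int ` {1..j}"
  shows "relabel (j + 1) (unlabel (j + 1) t) = t"
  using assms unfolding abs_in_int_image_iff
  by (auto simp: relabel_def unlabel_def nat_less_iff)

lemma unlabel_bounds:
  assumes "\<bar>t\<bar> \<le> int n" "j \<le> n" "t < 0 \<longleftrightarrow> \<bar>t\<bar> \<in> int ` {1..j}"
  shows "unlabel (j + 1) t \<in> {1..n + 1}"
  using assms unfolding abs_in_int_image_iff by (auto simp: unlabel_def)

text \<open>Reduces the check to the positions \<open>0..n\<close>. By oddness
  \<open>\<bar>f i\<bar>\<close> depends only on \<open>\<bar>i\<bar>\<close>, so a collision can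
  only be between \<open>i\<close> and \<open>- i\<close>; it forces \<open>f i = 0 = f 0\<close>
  and hence \<open>i = 0\<close>. An injective self-map of a finite set is bijective.\<close>

lemma odd_inj_permutes:
  fixes f :: "int \<Rightarrow> int"
  assumes odd: "\<And>i. f (- i) = - f i"
    and bound: "\<And>i. 0 \<le> i \<Longrightarrow> i \<le> int n \<Longrightarrow> \<bar>f i\<bar> \<le> int n"
    and inj: "\<And>i k. \<lbrakk>0 \<le> i; i \<le> int n; 0 \<le> k; k \<le> int n; \<bar>f i\<bar> = \<bar>f k\<bar>\<rbrakk> \<Longrightarrow> i = k"
    and outside: "\<And>i. i \<notin> {- int n..int n} \<Longrightarrow> f i = i"
  shows "f permutes {- int n..int n}"
proof -
  have abs_f: "\<bar>f \<bar>i\<bar>\<bar> = \<bar>f i\<bar>" for i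
    using odd[of i] by (auto simp: abs_if)
  have "f ` {- int n..int n} \<subseteq> {- int n..int n}"
  proof (rule image_subsetI)
    fix i assume "i \<in> {- int n..int n}"
    then show "f i \<in> {- int n..int n}"
      using bound[of "\<bar>i\<bar>"] abs_f[of i] unfolding atLeastAtMost_iff by linarith
  qed
  moreover have inj_on: "inj_on f {- int n..int n}"
  proof (rule inj_onI)
    fix i k assume ik: "i \<in> {- int n..int n}" "k \<in> {- int n..int n}" "f i = f k"
    then have "\<bar>i\<bar> = \<bar>k\<bar>"
      using inj[of "\<bar>i\<bar>" "\<bar>k\<bar>"] abs_f[of i] abs_f[of k] by auto
    show "i = k"
    proof (rule ccontr)
      assume "i \<noteq> k"
      with \<open>\<bar>i\<bar> = \<bar>k\<bar>\<close> have "k = - i" by linarith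
      then have "f i = 0" using odd[of i] ik by simp
      moreover have "f 0 = 0" using odd[of 0] by simp
      ultimately have "\<bar>i\<bar> = 0"
        using inj[of "\<bar>i\<bar>" 0] abs_f[of i] ik by auto
      with \<open>k = - i\<close> \<open>i \<noteq> k\<close> show False by simp
    qed
  qed
  ultimately have "bij_betw f {- int n..int n} {- int n..int n}"
    by (simp add: bij_betw_def endo_inj_surj)
  then show ?thesis
    using outside by (rule bij_imp_permutes)
qed

lemma permutes_atLeastAtMost_1:
  assumes "\<sigma> \<in> perms m" "i \<in> {1..m}"
  shows "\<sigma> i \<in> {1..m}"
  using assms permutes_in_image[of \<sigma> "{1..m}" i] by (simp add: perms_def)

text \<open>For \<open>i > 0\<close> injectivity of \<open>\<sigma>\<close> rules out the middle
  case of \<open>relabel\<close>, and the other two are those of \<open>tilde\<close>; at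
  \<open>i = 0\<close> both sides are \<open>0\<close>.\<close>

lemma F_eq_relabel:
  assumes \<sigma>: "\<sigma> \<in> perms (n + 1)" and i: "0 \<le> i" "i \<le> int n"
  shows "F n \<sigma> i = relabel (\<sigma> 1) (\<sigma> (nat i + 1))"
proof (cases "i = 0")
  case True
  then show ?thesis by (simp add: F_def relabel_def)
next
  case False
  with i have "nat i + 1 \<noteq> 1" by simp
  moreover have "inj \<sigma>"
    using \<sigma> by (auto simp: perms_def intro: permutes_inj)
  ultimately have "\<sigma> (nat i + 1) \<noteq> \<sigma> 1"
    by (metis injD)
  with False i show ?thesis
    by (simp add: F_def tilde_def relabel_def)
qed

lemma F_uminus: "F n \<sigma> (- i) = - F n \<sigma> i"
  by (auto simp: F_def)

lemma F_signed_perms: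
  assumes \<sigma>: "\<sigma> \<in> perms (n + 1)"
  shows "F n \<sigma> \<in> signed_perms n"
proof -
  have val: "\<sigma> (nat i + 1) \<in> {1..n + 1}" if "i \<le> int n" for i
    using permutes_atLeastAtMost_1[OF \<sigma>, of "nat i + 1"] that by auto
  have "F n \<sigma> permutes {- int n..int n}"
  proof (rule odd_inj_permutes)
    fix i :: int assume i: "0 \<le> i" "i \<le> int n"
    show "\<bar>F n \<sigma> i\<bar> \<le> int n"
      unfolding F_eq_relabel[OF \<sigma> i] using val[of 0] val[OF i(2)] by (intro abs_relabel_le) auto
  next
    fix i k :: int
    assume i: "0 \<le> i" "i \<le> int n" and k: "0 \<le> k" "k \<le> int n"
      and eq: "\<bar>F n \<sigma> i\<bar> = \<bar>F n \<sigma> k\<bar>"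
    have "\<sigma> (nat i + 1) = \<sigma> (nat k + 1)"
      using eq val[OF i(2)] val[OF k(2)]
      unfolding F_eq_relabel[OF \<sigma> i] F_eq_relabel[OF \<sigma> k]
      by (intro abs_relabel_inj) auto
    moreover have "inj \<sigma>"
      using \<sigma> by (auto simp: perms_def intro: permutes_inj)
    ultimately have "nat i + 1 = nat k + 1" by (metis injD)
    with i k show "i = k" by simp
  qed (auto simp: F_uminus, auto simp: F_def)
  then show ?thesis
    by (simp add: signed_perms_def F_uminus)
qed

text \<open>Positions \<open>i - 1\<close> and \<open>i\<close> of the signed word carry the
  relabelled \<open>\<sigma> i\<close> and \<open>\<sigma> (i + 1)\<close>, so the two descent sets
  coincide up to the coercion \<open>int\<close>, including \<open>i = 1\<close>.\<close>

lemma signed_des_F: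
  assumes \<sigma>: "\<sigma> \<in> perms (n + 1)"
  shows "signed_des n (F n \<sigma>) = descents (n + 1) \<sigma>"
proof -
  have \<sigma>1: "\<sigma> 1 \<ge> 1"
    using permutes_atLeastAtMost_1[OF \<sigma>, of 1] by simp
  have des: "F n \<sigma> i < F n \<sigma> (i - 1) \<longleftrightarrow> \<sigma> (nat i + 1) < \<sigma> (nat i)" if "i \<in> {1..int n}" for i
  proof -
    have "nat (i - 1) + 1 = nat i" using that by auto
    with that show ?thesis
      using F_eq_relabel[OF \<sigma>, of i] F_eq_relabel[OF \<sigma>, of "i - 1"] relabel_less_iff[OF \<sigma>1]
      by simp
  qed
  have "{i \<in> {1..int n}. F n \<sigma> i < F n \<sigma> (i - 1)}
      = int ` {i. 1 \<le> i \<and> i < n + 1 \<and> \<sigma> (i + 1) < \<sigma> i}" (is "?L = int ` ?R")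
  proof (intro equalityI subsetI)
    fix i assume "i \<in> ?L"
    then have "nat i \<in> ?R" "i = int (nat i)" using des[of i] by auto
    then show "i \<in> int ` ?R" by (rule rev_image_eqI)
  next
    fix i assume "i \<in> int ` ?R"
    then show "i \<in> ?L" using des[of i] by auto
  qed
  then show ?thesis
    by (simp add: signed_des_def descents_def card_image)
qed

lemma F_signed_perms_des_neg:
  assumes "\<sigma> \<in> perms_des_first (n + 1) k (j + 1)"
  shows "F n \<sigma> \<in> signed_perms_des_neg n k {1..j}"
proof -
  have \<sigma>: "\<sigma> \<in> perms (n + 1)" and des: "descents (n + 1) \<sigma> = k" and first: "\<sigma> 1 = j + 1"
    using assms by (auto simp: perms_des_first_def perms_des_def)
  have "F n \<sigma> i < 0 \<longleftrightarrow> \<bar>F n \<sigma> i\<bar> \<in> int ` {1..j}" if "i \<in> {1..int n}" for i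
  proof -
    have "F n \<sigma> i = relabel (j + 1) (\<sigma> (nat i + 1))"
      using F_eq_relabel[OF \<sigma>, of i] that first by simp
    moreover have "\<sigma> (nat i + 1) \<ge> 1"
      using permutes_atLeastAtMost_1[OF \<sigma>, of "nat i + 1"] that by auto
    ultimately show ?thesis by (simp only: relabel_neg_iff)
  qed
  then show ?thesis
    using F_signed_perms[OF \<sigma>] signed_des_F[OF \<sigma>] des
    by (simp add: signed_perms_des_neg_def signed_perms_des_def)
qed

text \<open>Both permutations start with \<open>j + 1\<close>, so the same injective relabelling is
  applied to each and can be cancelled.\<close>

lemma inj_on_F: "inj_on (F n) (perms_des_first (n + 1) k (j + 1))"
proof (rule inj_onI, rule ext)
  fix \<sigma> \<tau> i
  assume "\<sigma> \<in> perms_des_first (n + 1) k (j + 1)" "\<tau> \<in> perms_des_first (n + 1) k (j + 1)"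
    and eq: "F n \<sigma> = F n \<tau>"
  then have \<sigma>: "\<sigma> \<in> perms (n + 1)" "\<sigma> 1 = j + 1" and \<tau>: "\<tau> \<in> perms (n + 1)" "\<tau> 1 = j + 1"
    by (auto simp: perms_des_first_def perms_des_def)
  show "\<sigma> i = \<tau> i"
  proof (cases "i \<in> {1..n + 1}")
    case True
    then have "0 \<le> int i - 1" "int i - 1 \<le> int n" "nat (int i - 1) + 1 = i" by auto
    then have "relabel (j + 1) (\<sigma> i) = relabel (j + 1) (\<tau> i)"
      using F_eq_relabel[OF \<sigma>(1), of "int i - 1"] F_eq_relabel[OF \<tau>(1), of "int i - 1"]
        \<sigma>(2) \<tau>(2) eq by simp
    then show ?thesis by (rule relabel_inj[rotated]) simp
  next
    case False
    then show ?thesis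
      using \<sigma>(1) \<tau>(1) unfolding perms_def by (metis mem_Collect_eq permutes_not_in)
  qed
qed

lemma F_surj:
  assumes "j \<le> n" and \<tau>: "\<tau> \<in> signed_perms_des_neg n k {1..j}"
  shows "\<exists>\<sigma> \<in> perms_des_first (n + 1) k (j + 1). F n \<sigma> = \<tau>"
proof -
  have perm: "\<tau> permutes {- int n..int n}" and odd: "\<And>i. \<tau> (- i) = - \<tau> i"
    and des: "signed_des n \<tau> = k"
    and "\<And>i. i \<in> {1..int n} \<Longrightarrow> \<tau> i < 0 \<longleftrightarrow> \<bar>\<tau> i\<bar> \<in> int ` {1..j}"
    using \<tau> by (auto simp: signed_perms_des_neg_def signed_perms_des_def signed_perms_def)
  moreover have zero: "\<tau> 0 = 0" using odd[of 0] by simp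
  \<comment> \<open>The sign condition extends to \<open>i = 0\<close>, where both sides are false;
    this lets \<open>relabel_unlabel\<close> treat the first entry as well.\<close>
  ultimately have neg: "\<tau> i < 0 \<longleftrightarrow> \<bar>\<tau> i\<bar> \<in> int ` {1..j}" if "0 \<le> i" "i \<le> int n" for i
    using that by (cases "i = 0") auto
  \<comment> \<open>The preimage undoes the relabelling entry by entry, with the positions
    \<open>0..n\<close> shifted to \<open>1..n + 1\<close>.\<close>
  define \<sigma> where "\<sigma> i = (if i \<in> {1..n + 1} then unlabel (j + 1) (\<tau> (int i - 1)) else i)" for i
  have relabel_\<sigma>: "relabel (j + 1) (\<sigma> i) = \<tau> (int i - 1)" if "i \<in> {1..n + 1}" for i
    using that neg[of "int i - 1"] by (simp add: \<sigma>_def relabel_unlabel del: One_nat_def)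
  have "inj_on \<sigma> {1..n + 1}"
  proof (rule inj_onI)
    fix i l assume "i \<in> {1..n + 1}" "l \<in> {1..n + 1}" "\<sigma> i = \<sigma> l"
    \<comment> \<open>Relabelling recovers \<open>\<tau>\<close> from \<open>\<sigma>\<close>, so
      injectivity is inherited from \<open>\<tau>\<close>.\<close>
    then have "\<tau> (int i - 1) = \<tau> (int l - 1)"
      using relabel_\<sigma> by metis
    then show "i = l" using permutes_inj[OF perm] by (auto dest: injD)
  qed
  moreover have "\<sigma> ` {1..n + 1} \<subseteq> {1..n + 1}"
  proof (rule image_subsetI)
    fix i assume i: "i \<in> {1..n + 1}"
    then have "\<tau> (int i - 1) \<in> {- int n..int n}"
      using permutes_in_image[OF perm] by auto
    then have "unlabel (j + 1) (\<tau> (int i - 1)) \<in> {1..n + 1}"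
      using i assms(1) neg[of "int i - 1"] by (intro unlabel_bounds) auto
    with i show "\<sigma> i \<in> {1..n + 1}" by (simp add: \<sigma>_def)
  qed
  ultimately have "bij_betw \<sigma> {1..n + 1} {1..n + 1}"
    by (simp add: bij_betw_def endo_inj_surj)
  then have "\<sigma> permutes {1..n + 1}"
    by (rule bij_imp_permutes) (auto simp: \<sigma>_def)
  then have \<sigma>: "\<sigma> \<in> perms (n + 1)" by (simp add: perms_def)
  have first: "\<sigma> 1 = j + 1" by (simp add: \<sigma>_def zero unlabel_def)
  have nonneg: "F n \<sigma> i = \<tau> i" if "0 \<le> i" "i \<le> int n" for i
    using F_eq_relabel[OF \<sigma> that] relabel_\<sigma>[of "nat i + 1"] first that by auto
  have "F n \<sigma> = \<tau>"
  proof
    fix i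
    consider "0 \<le> i" "i \<le> int n" | "0 \<le> - i" "- i \<le> int n" | "i \<notin> {- int n..int n}"
      by fastforce
    then show "F n \<sigma> i = \<tau> i"
    proof cases
      case 1
      then show ?thesis by (rule nonneg)
    next
      case 2
      then show ?thesis using nonneg[of "- i"] odd[of i] F_uminus[of n \<sigma> i] by simp
    next
      case 3
      then show ?thesis using permutes_not_in[OF perm] by (auto simp: F_def)
    qed
  qed
  moreover have "descents (n + 1) \<sigma> = k"
    \<comment> \<open>Descents of the preimage need no separate count: \<open>F\<close> preserves
      them and \<open>\<tau>\<close> has \<open>k\<close>.\<close>
    using signed_des_F[OF \<sigma>] des \<open>F n \<sigma> = \<tau>\<close> by simp
  ultimately show ?thesis
    using \<sigma> first by (auto simp: perms_des_first_def perms_des_def)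
qed

theorem theorem5p1:
  fixes n :: nat
  shows "F n \<in> perms (n + 1) \<rightarrow> signed_perms n
    \<and> (\<forall>j k. j \<le> n \<and> k \<le> n \<longrightarrow>
          F n \<in> perms_des (n + 1) k \<rightarrow> signed_perms_des n k
        \<and> bij_betw (F n) (perms_des_first (n + 1) k (j + 1)) (signed_perms_des_neg n k {1..j})
        \<and> b n k j = card (perms_des_first (n + 1) k (j + 1)))"
proof (intro conjI allI impI)
  show "F n \<in> perms (n + 1) \<rightarrow> signed_perms n"
    using F_signed_perms by auto
next
  fix j k :: nat assume "j \<le> n \<and> k \<le> n"
  then have "j \<le> n" by simp
  show "F n \<in> perms_des (n + 1) k \<rightarrow> signed_perms_des n k"
    using F_signed_perms signed_des_F by (auto simp: perms_des_def signed_perms_des_def)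
  have "F n ` perms_des_first (n + 1) k (j + 1) = signed_perms_des_neg n k {1..j}"
  proof (intro equalityI image_subsetI subsetI F_signed_perms_des_neg)
    fix \<tau> assume "\<tau> \<in> signed_perms_des_neg n k {1..j}"
    then show "\<tau> \<in> F n ` perms_des_first (n + 1) k (j + 1)"
      using F_surj[OF \<open>j \<le> n\<close>] by blast
  qed
  then show bij:
    "bij_betw (F n) (perms_des_first (n + 1) k (j + 1)) (signed_perms_des_neg n k {1..j})"
    using inj_on_F by (rule bij_betw_imageI[rotated])
  show "b n k j = card (perms_des_first (n + 1) k (j + 1))"
    using bij_betw_same_card[OF bij] by (simp add: b_def)
qed

end
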